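(* Let $X_1,\ldots,X_n$ be independent (centered) Gaussian mixtures. Then for every $\alpha \geq 1$ the function $$\triangle^{n-1} \ni (a_1^2,\ldots,a_n^2) \longmapsto h_\alpha\Big(\sum_{i=1}^n a_i X_i\Big)$$ is concave on $\triangle^{n-1}$.
   Context: A (centered) Gaussian mixture is a real random variable of the form $X = YZ$, where $Y$ is an almost surely positive random variable and $Z$ is a standard Gaussian random variable independent of $Y$. $\triangle^{n-1} = \{(\pi_1,\ldots,\pi_n)\in[0,1]^n : \pi_1+\cdots+\pi_n = 1\}$ is the standard simplex (the function depends on $(a_1,\dots,a_n)$ only through $(a_1^2,\dots,a_n^2)$ since the $X_i$ are symmetric). For a random variable $X$ with density $f$ and $\alpha\neq 1$, the Rényi entropy is $h_\alpha(X) = \frac{1}{1-\alpha}\log\int_{\mathbb{R}} f^\alpha(x)\,dx$, and $h_1(X) = h(X) = -\int f\log f$ is the Shannon entropy. *)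

theory Defs
  imports "HOL-Probability.Probability"
begin

definition std_gaussian :: "real measure" where
  "std_gaussian = density lborel (\<lambda>x. ennreal (std_normal_density x))"

definition gaussian_mixture_law :: "real measure \<Rightarrow> bool" where
  "gaussian_mixture_law \<mu> \<longleftrightarrow>
     (\<exists>\<nu>. prob_space \<nu> \<and> sets \<nu> = sets borel \<and> emeasure \<nu> {0<..} = 1 \<and>
          \<mu> = distr (\<nu> \<Otimes>\<^sub>M std_gaussian) borel (\<lambda>(y, z). y * z))"

definition gaussian_mixture :: "'a measure \<Rightarrow> ('a \<Rightarrow> real) \<Rightarrow> bool" where
  "gaussian_mixture M X \<longleftrightarrow> gaussian_mixture_law (distr M borel X)"

definition law_density :: "real measure \<Rightarrow> real \<Rightarrow> real" where
  "law_density \<mu> x = enn2real (RN_deriv lborel \<mu> x)"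

(* Renyi entropy h_alpha of a law with density f = law_density mu, extended-real valued.
   alpha = 1: Shannon entropy -int f log f = int f (log f)^- - int f (log f)^+ .
   alpha <> 1: (1/(1-alpha)) log int f^alpha, where log(+infinity) = +infinity. *)
definition renyi_entropy :: "real \<Rightarrow> real measure \<Rightarrow> ereal" where
  "renyi_entropy \<alpha> \<mu> =
     (let f = law_density \<mu> in
      if \<alpha> = 1 then
        enn2ereal (\<integral>\<^sup>+ x. ennreal (f x * max 0 (- ln (f x))) \<partial>lborel)
        - enn2ereal (\<integral>\<^sup>+ x. ennreal (f x * max 0 (ln (f x))) \<partial>lborel)
      else
        (let I = \<integral>\<^sup>+ x. ennreal (f x powr \<alpha>) \<partial>lborel in
         if I = \<infinity> then (if \<alpha> > 1 then - \<infinity> else \<infinity>)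
         else ereal (ln (enn2real I) / (1 - \<alpha>))))"

definition std_simplex :: "nat \<Rightarrow> (nat \<Rightarrow> real) set" where
  "std_simplex n = {p. (\<forall>i<n. 0 \<le> p i) \<and> (\<Sum>i<n. p i) = 1}"

definition concave_on_simplex :: "nat \<Rightarrow> ((nat \<Rightarrow> real) \<Rightarrow> ereal) \<Rightarrow> bool" where
  "concave_on_simplex n H \<longleftrightarrow>
     (\<forall>p\<in>std_simplex n. \<forall>q\<in>std_simplex n. \<forall>t::real. 0 \<le> t \<and> t \<le> 1 \<longrightarrow>
        ereal t * H p + ereal (1 - t) * H q \<le> H (\<lambda>i. t * p i + (1 - t) * q i))"

end

theory Submission
  imports Defs
begin

text \<open>
  Put \<open>\<gamma>\<close> for the standard Gaussian law. The sum \<open>\<Sum>i<n. sqrt (p i) * X i\<close> has the law of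
  \<open>sqrt (W\<^sub>p y) * z\<close> with \<open>z\<close> drawn from \<open>\<gamma>\<close> and \<open>W\<^sub>p y = (\<Sum>i<n. p i * (y i)\<^sup>2)\<close> drawn independently;
  this couples all weights \<open>p\<close>, with \<open>W\<^sub>p\<close> affine in \<open>p\<close>. Its density is \<open>G\<^sub>p (x\<^sup>2)\<close> where \<open>G\<^sub>p\<close> is a mixture of
  exponentials, hence decreasing and log-convex. For \<open>r = t * p + (1 - t) * q\<close>, log-convexity of
  \<open>G\<^sub>r\<close> compares the integral of \<open>ln f\<^sub>r\<close> (or of \<open>f\<^sub>r powr (\<alpha> - 1)\<close>) against \<open>f\<^sub>r\<close> with those against \<open>f\<^sub>p\<close>
  and \<open>f\<^sub>q\<close>, and Gibbs' inequality (or Holder's) replaces these cross terms by the entropies of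
  \<open>f\<^sub>p\<close> and \<open>f\<^sub>q\<close>.
\<close>

section \<open>Laws of weighted sums of Gaussian mixtures\<close>

lemma prob_space_std_gaussian: "prob_space std_gaussian"
  using real_distribution.axioms(1)[OF real_dist_normal_dist] by (simp add: std_gaussian_def)

lemma sets_std_gaussian [simp, measurable_cong]: "sets std_gaussian = sets borel"
  by (simp add: std_gaussian_def)

text \<open>Given \<open>y\<close>, the variable \<open>V y * z\<close> is centred Gaussian with
  standard deviation \<open>V y\<close> up to sign, so Fubini leaves the average of Gaussian
  characteristic functions. It serves both for one summand, with \<open>V\<close> the identity, and
  for the whole sum.\<close>

lemma char_scaled_gaussian:
  fixes K :: "'b measure" and V :: "'b \<Rightarrow> real"
  assumes "prob_space K" and [measurable]: "V \<in> borel_measurable K"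
  shows "char (distr (K \<Otimes>\<^sub>M std_gaussian) borel (\<lambda>(y, z). V y * z)) t =
         (LINT y|K. complex_of_real (exp (- (t * V y)\<^sup>2 / 2)))"
proof -
  interpret K: prob_space K by fact
  interpret G: prob_space std_gaussian by (rule prob_space_std_gaussian)
  interpret P: pair_prob_space K std_gaussian ..
  have int: "integrable (K \<Otimes>\<^sub>M std_gaussian) (\<lambda>x. iexp (t * (case x of (y, z) \<Rightarrow> V y * z)))"
    by (rule P.integrable_const_bound[where B = 1]) auto
  have "char (distr (K \<Otimes>\<^sub>M std_gaussian) borel (\<lambda>(y, z). V y * z)) t =
        (LINT x|(K \<Otimes>\<^sub>M std_gaussian). iexp (t * (case x of (y, z) \<Rightarrow> V y * z)))"
    unfolding char_def by (subst integral_distr) auto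
  also have "\<dots> = (LINT y|K. LINT z|std_gaussian. iexp ((t * V y) * z))"
    using P.integral_fst'[OF int] by (simp add: mult.assoc)
  also have "\<dots> = (LINT y|K. char std_gaussian (t * V y))"
    by (simp add: char_def)
  finally show ?thesis
    by (simp add: std_gaussian_def char_std_normal_distribution)
qed

text \<open>Nonpositive \<open>y i\<close> form a null set; replacing them by \<open>1\<close> makes the variance positive
  everywhere when \<open>p\<close> lies in the simplex.\<close>

definition mixing_variance :: "(nat \<Rightarrow> real) \<Rightarrow> nat \<Rightarrow> (nat \<Rightarrow> real) \<Rightarrow> real" where
  "mixing_variance p n y = (\<Sum>i<n. p i * (if 0 < y i then y i else 1)\<^sup>2)"

text \<open>Characteristic functions are compared: independence gives a product, and the exponents
  of the Gaussian factors add up to the mixing variance. The space \<open>K\<close> of the mixing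
  variables is fixed before \<open>p\<close>; this is the coupling on which all later comparisons
  rest.\<close>

lemma weighted_mixture_sum_law:
  fixes M :: "'a measure" and X :: "nat \<Rightarrow> 'a \<Rightarrow> real" and n :: nat
  assumes "prob_space M"
    and X [measurable]: "\<And>i. i < n \<Longrightarrow> X i \<in> borel_measurable M"
    and indep: "prob_space.indep_vars M (\<lambda>_. borel) X {..<n}"
    and mix: "\<And>i. i < n \<Longrightarrow> gaussian_mixture M (X i)"
  shows "\<exists>K. prob_space K \<and> (\<forall>p. mixing_variance p n \<in> borel_measurable K) \<and>
    (\<forall>p. (\<forall>i<n. 0 \<le> p i) \<longrightarrow>
       distr M borel (\<lambda>\<omega>. \<Sum>i<n. sqrt (p i) * X i \<omega>) =
       distr (K \<Otimes>\<^sub>M std_gaussian) borel (\<lambda>(y, z). sqrt (mixing_variance p n y) * z))"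
proof -
  interpret M: prob_space M by fact
  interpret G: prob_space std_gaussian by (rule prob_space_std_gaussian)
  define law where "law i \<nu> \<longleftrightarrow> prob_space \<nu> \<and> sets \<nu> = sets borel \<and> emeasure \<nu> {0<..} = 1 \<and>
     distr M borel (X i) = distr (\<nu> \<Otimes>\<^sub>M std_gaussian) borel (\<lambda>(y, z). y * z)" for i and \<nu> :: "real measure"
  have "\<exists>\<nu>. law i \<nu>" if "i < n" for i
    using mix[OF that] by (simp add: gaussian_mixture_def gaussian_mixture_law_def law_def)
  then obtain \<nu>0 where \<nu>0: "\<And>i. i < n \<Longrightarrow> law i (\<nu>0 i)"
    by metis
  \<comment> \<open>Outside the index range a point mass is a dummy value: the product locale asks
    for a probability space at every index.\<close>
  define \<nu> where "\<nu> i = (if i < n then \<nu>0 i else return borel 0)" for i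
  have prob: "prob_space (\<nu> i)" for i
    using \<nu>0 by (auto simp: \<nu>_def law_def intro: prob_space_return)
  have sets [simp, measurable_cong]: "sets (\<nu> i) = sets borel" for i
    using \<nu>0 by (auto simp: \<nu>_def law_def)
  interpret P: product_prob_space \<nu> "{..<n}"
    by (simp add: product_prob_space_def product_prob_space_axioms_def product_sigma_finite_def
        prob prob_space_imp_sigma_finite)
  define K where "K = PiM {..<n} \<nu>"
  interpret K: prob_space K
    unfolding K_def by (rule prob_space_PiM) (rule prob)
  have V [measurable]: "mixing_variance p n \<in> borel_measurable K" for p
    unfolding mixing_variance_def K_def by measurable
  define pos where "pos y = (if 0 < y then y else 1)" for y :: real
  have pos [measurable]: "pos \<in> borel_measurable borel"
    unfolding pos_def by measurable
  have "distr M borel (\<lambda>\<omega>. \<Sum>i<n. sqrt (p i) * X i \<omega>) =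
       distr (K \<Otimes>\<^sub>M std_gaussian) borel (\<lambda>(y, z). sqrt (mixing_variance p n y) * z)"
    if p: "\<forall>i<n. 0 \<le> p i" for p
  proof (rule Levy_uniqueness)
    show "real_distribution (distr M borel (\<lambda>\<omega>. \<Sum>i<n. sqrt (p i) * X i \<omega>))"
      by (rule M.real_distribution_distr) measurable
    interpret KG: pair_prob_space K std_gaussian ..
    show "real_distribution (distr (K \<Otimes>\<^sub>M std_gaussian) borel (\<lambda>(y, z). sqrt (mixing_variance p n y) * z))"
      by (rule KG.real_distribution_distr) measurable
    have factor: "char (distr M borel (\<lambda>\<omega>. sqrt (p i) * X i \<omega>)) t =
        (LINT y|\<nu> i. complex_of_real (exp (- (t\<^sup>2 * p i * (pos y)\<^sup>2) / 2)))" if i: "i < n" for i t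
    proof -
      have "char (distr M borel (\<lambda>\<omega>. sqrt (p i) * X i \<omega>)) t = char (distr M borel (X i)) (t * sqrt (p i))"
        unfolding char_def using i by (simp add: integral_distr mult.assoc)
      also have "\<dots> = char (distr (\<nu> i \<Otimes>\<^sub>M std_gaussian) borel (\<lambda>(y, z). y * z)) (t * sqrt (p i))"
        using \<nu>0[OF i] i by (simp add: law_def \<nu>_def)
      also have "\<dots> = (LINT y|\<nu> i. complex_of_real (exp (- (t * sqrt (p i) * y)\<^sup>2 / 2)))"
        using char_scaled_gaussian[OF prob, of "\<lambda>y. y"] by simp
      \<comment> \<open>The mixing law gives mass one to the positive reals, where
        \<open>pos y = y\<close>.\<close>
      also have "\<dots> = (LINT y|\<nu> i. complex_of_real (exp (- (t\<^sup>2 * p i * (pos y)\<^sup>2) / 2)))"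
      proof (rule integral_cong_AE)
        have "emeasure (\<nu> i) {0<..} = 1"
          using \<nu>0[OF i] i by (simp add: law_def \<nu>_def)
        then have "AE y in \<nu> i. y \<in> {0<..}"
          by (intro prob_space.AE_prob_1[OF prob]) (simp add: measure_def)
        then show "AE y in \<nu> i. complex_of_real (exp (- (t * sqrt (p i) * y)\<^sup>2 / 2)) =
            complex_of_real (exp (- (t\<^sup>2 * p i * (pos y)\<^sup>2) / 2))"
          by eventually_elim (use p i in \<open>simp add: pos_def power_mult_distrib\<close>)
      qed measurable
      finally show ?thesis .
    qed
    have "char (distr M borel (\<lambda>\<omega>. \<Sum>i<n. sqrt (p i) * X i \<omega>)) t =
      char (distr (K \<Otimes>\<^sub>M std_gaussian) borel (\<lambda>(y, z). sqrt (mixing_variance p n y) * z)) t" for t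
    proof -
      have "M.indep_vars (\<lambda>_. borel) (\<lambda>i \<omega>. sqrt (p i) * X i \<omega>) {..<n}"
        using M.indep_vars_compose2[OF indep, of "\<lambda>i x. sqrt (p i) * x" "\<lambda>_. borel"] by simp
      then have "char (distr M borel (\<lambda>\<omega>. \<Sum>i<n. sqrt (p i) * X i \<omega>)) t =
          (\<Prod>i<n. char (distr M borel (\<lambda>\<omega>. sqrt (p i) * X i \<omega>)) t)"
        by (rule M.char_distr_sum)
      also have "\<dots> = (\<Prod>i<n. (LINT y|\<nu> i. complex_of_real (exp (- (t\<^sup>2 * p i * (pos y)\<^sup>2) / 2))))"
        by (intro prod.cong refl) (simp add: factor)
      also have "\<dots> = (LINT y|K. (\<Prod>i<n. complex_of_real (exp (- (t\<^sup>2 * p i * (pos (y i))\<^sup>2) / 2))))"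
        unfolding K_def
      proof (rule P.product_integral_prod[symmetric])
        fix i assume "i \<in> {..<n}"
        show "integrable (\<nu> i) (\<lambda>y. complex_of_real (exp (- (t\<^sup>2 * p i * (pos y)\<^sup>2) / 2)))"
          using \<open>i \<in> {..<n}\<close> p by (intro finite_measure.integrable_const_bound[where B = 1] prob_space.finite_measure[OF prob]) auto
      qed simp
      also have "\<dots> = (LINT y|K. complex_of_real (exp (- (t * sqrt (mixing_variance p n y))\<^sup>2 / 2)))"
      proof (rule Bochner_Integration.integral_cong[OF refl])
        fix y
        have "0 \<le> mixing_variance p n y"
          using p by (auto simp: mixing_variance_def intro!: sum_nonneg)
        \<comment> \<open>Nonnegativity of the variance makes the squared root collapse, and the
          exponent splits into the exponents of the single factors.\<close>
        then have "- (t * sqrt (mixing_variance p n y))\<^sup>2 / 2 = (\<Sum>i<n. - (t\<^sup>2 * p i * (pos (y i))\<^sup>2) / 2)"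
          by (simp add: power_mult_distrib mixing_variance_def pos_def sum_distrib_left
              sum_negf sum_divide_distrib mult.assoc)
        then show "(\<Prod>i<n. complex_of_real (exp (- (t\<^sup>2 * p i * (pos (y i))\<^sup>2) / 2))) =
            complex_of_real (exp (- (t * sqrt (mixing_variance p n y))\<^sup>2 / 2))"
          by (simp only: exp_sum[OF finite_lessThan] of_real_prod)
      qed
      also have "\<dots> = char (distr (K \<Otimes>\<^sub>M std_gaussian) borel (\<lambda>(y, z). sqrt (mixing_variance p n y) * z)) t"
        by (rule char_scaled_gaussian[symmetric]) (auto intro: K.prob_space_axioms)
      finally show ?thesis .
    qed
    then show "char (distr M borel (\<lambda>\<omega>. \<Sum>i<n. sqrt (p i) * X i \<omega>)) =
      char (distr (K \<Otimes>\<^sub>M std_gaussian) borel (\<lambda>(y, z). sqrt (mixing_variance p n y) * z))"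
      by blast
  qed
  then show ?thesis
    using K.prob_space_axioms V by blast
qed

section \<open>Densities of Gaussian mixtures\<close>

lemma weighted_AM_GM:
  fixes a b t :: real
  assumes "0 \<le> a" "0 \<le> b" "0 \<le> t" "t \<le> 1"
  shows "a powr t * b powr (1 - t) \<le> t * a + (1 - t) * b"
proof (cases "a = 0 \<or> b = 0")
  case True
  then show ?thesis using assms by auto
next
  case False
  then show ?thesis using assms Youngs_inequality_0[of t "1 - t" a b] by auto
qed

text \<open>Weighted AM-GM is applied pointwise to \<open>f x / A\<close> and \<open>g x / B\<close>
  and then integrated. Positive upper bounds \<open>A\<close> and \<open>B\<close> in place of the
  integrals themselves avoid the cases of a zero or infinite integral.\<close>

lemma nn_integral_Holder:
  fixes f g :: "'a \<Rightarrow> real"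
  assumes [measurable]: "f \<in> borel_measurable M" "g \<in> borel_measurable M"
    and nonneg: "\<And>x. 0 \<le> f x" "\<And>x. 0 \<le> g x"
    and A: "(\<integral>\<^sup>+x. ennreal (f x) \<partial>M) \<le> ennreal A" "0 < A"
    and B: "(\<integral>\<^sup>+x. ennreal (g x) \<partial>M) \<le> ennreal B" "0 < B"
    and t: "0 \<le> t" "t \<le> 1"
  shows "(\<integral>\<^sup>+x. ennreal (f x powr t * g x powr (1 - t)) \<partial>M) \<le> ennreal (A powr t * B powr (1 - t))"
proof -
  define C where "C = A powr t * B powr (1 - t)"
  have C: "0 \<le> C" by (simp add: C_def)
  have "(\<integral>\<^sup>+x. ennreal (f x powr t * g x powr (1 - t)) \<partial>M) \<le>
        (\<integral>\<^sup>+x. ennreal (C * t / A) * ennreal (f x) + ennreal (C * (1 - t) / B) * ennreal (g x) \<partial>M)"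
  proof (rule nn_integral_mono)
    fix x
    have "f x powr t * g x powr (1 - t) = C * ((f x / A) powr t * (g x / B) powr (1 - t))"
      using A B by (simp add: C_def powr_divide nonneg)
    also have "\<dots> \<le> C * (t * (f x / A) + (1 - t) * (g x / B))"
      using A B t C nonneg by (intro mult_left_mono weighted_AM_GM) auto
    also have "\<dots> = C * t / A * f x + C * (1 - t) / B * g x"
      by (simp add: field_simps)
    finally show "ennreal (f x powr t * g x powr (1 - t)) \<le>
        ennreal (C * t / A) * ennreal (f x) + ennreal (C * (1 - t) / B) * ennreal (g x)"
      using A B t C nonneg by (simp add: ennreal_mult[symmetric] ennreal_plus[symmetric] ennreal_leI del: ennreal_plus)
  qed
  also have "\<dots> = ennreal (C * t / A) * (\<integral>\<^sup>+x. ennreal (f x) \<partial>M) +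
      ennreal (C * (1 - t) / B) * (\<integral>\<^sup>+x. ennreal (g x) \<partial>M)"
    by (simp add: nn_integral_add nn_integral_cmult)
  also have "\<dots> \<le> ennreal (C * t / A) * ennreal A + ennreal (C * (1 - t) / B) * ennreal B"
    by (intro add_mono mult_left_mono A B) auto
  also have "\<dots> = ennreal (C * t) + ennreal (C * (1 - t))"
    using A B t C by (simp add: ennreal_mult'[symmetric])
  also have "\<dots> = ennreal C"
    using t C by (simp add: ennreal_plus[symmetric] distrib_left[symmetric] del: ennreal_plus)
  finally show ?thesis by (simp add: C_def)
qed

text \<open>This is \<open>u \<le> exp u\<close> at \<open>u = w / s\<close>, with the factor
  \<open>2 * pi\<close> estimated by \<open>1\<close>. The bound does not involve \<open>s\<close>,
  so mixtures converge at every \<open>w > 0\<close> whatever the mixing law.\<close>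

lemma exp_neg_div_sqrt_bound:
  fixes w s :: real
  assumes "0 < w" "0 < s"
  shows "exp (- w / (2 * s)) / sqrt (2 * pi * s) \<le> 1 / sqrt w"
proof -
  have "w / s \<le> exp (w / s)"
    using exp_ge_add_one_self[of "w / s"] by linarith
  also have "\<dots> = (exp (w / (2 * s)))\<^sup>2"
    by (simp add: power2_eq_square exp_add[symmetric] field_simps)
  finally have "sqrt (w / s) \<le> exp (w / (2 * s))"
    by (intro real_le_lsqrt) (use assms in auto)
  then have "exp (- w / (2 * s)) \<le> sqrt s / sqrt w"
    using assms by (simp add: exp_minus real_sqrt_divide field_simps)
  moreover have "sqrt s \<le> sqrt (2 * pi * s)"
  proof -
    have "1 * s \<le> (2 * pi) * s"
      using assms pi_gt3 by (intro mult_right_mono) auto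
    then show ?thesis by simp
  qed
  ultimately have "exp (- w / (2 * s)) \<le> sqrt (2 * pi * s) / sqrt w"
    using assms by (meson divide_right_mono order_trans real_sqrt_ge_zero less_imp_le)
  then show ?thesis
    using assms by (simp add: field_simps)
qed

section \<open>Log-convex mixtures of exponentials\<close>

definition gauss_weight :: "real \<Rightarrow> real" where
  "gauss_weight s = 1 / sqrt (2 * pi * s)"

lemma gauss_weight_measurable [measurable]: "gauss_weight \<in> borel_measurable borel"
  unfolding gauss_weight_def by measurable

lemma gauss_weight_pos: "0 < s \<Longrightarrow> 0 < gauss_weight s"
  by (simp add: gauss_weight_def)

text \<open>With \<open>c y = gauss_weight (W y)\<close> and \<open>w = x\<^sup>2\<close> this is
  the mixture of centred Gaussian densities of variance \<open>W y\<close> at \<open>x\<close>. The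
  weight \<open>c\<close> is kept separate from \<open>W\<close> so that it can be truncated without
  changing the exponentials.\<close>

definition profile :: "'b measure \<Rightarrow> ('b \<Rightarrow> real) \<Rightarrow> ('b \<Rightarrow> real) \<Rightarrow> real \<Rightarrow> real" where
  "profile K c W w = (LINT y|K. c y * exp (- w / (2 * W y)))"

locale mixing_weight = prob_space K for K :: "'b measure" +
  fixes c W :: "'b \<Rightarrow> real"
  assumes W_measurable [measurable]: "W \<in> borel_measurable K"
    and W_pos: "0 < W y"
    and c_measurable [measurable]: "c \<in> borel_measurable K"
    and c_pos: "0 < c y"
    and c_le: "c y \<le> gauss_weight (W y)"
begin

lemma profile_measurable [measurable]: "profile K c W \<in> borel_measurable borel"
  unfolding profile_def by measurable

lemma profile_integrable:
  assumes "0 < w"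
  shows "integrable K (\<lambda>y. c y * exp (- w / (2 * W y)))"
proof (rule integrable_const_bound[where B = "1 / sqrt w"])
  show "AE y in K. norm (c y * exp (- w / (2 * W y))) \<le> 1 / sqrt w"
  proof (rule AE_I2)
    fix y
    have "c y * exp (- w / (2 * W y)) \<le> gauss_weight (W y) * exp (- w / (2 * W y))"
      by (intro mult_right_mono c_le) simp
    also have "\<dots> \<le> 1 / sqrt w"
      using exp_neg_div_sqrt_bound[OF assms W_pos] by (simp add: gauss_weight_def)
    finally show "norm (c y * exp (- w / (2 * W y))) \<le> 1 / sqrt w"
      using c_pos[of y] by simp
  qed
qed measurable

lemma profile_nonneg: "0 \<le> profile K c W w"
  unfolding profile_def by (intro integral_nonneg_AE AE_I2) (simp add: c_pos less_imp_le)

lemma profile_pos: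
  assumes "0 < w"
  shows "0 < profile K c W w"
proof -
  have "profile K c W w \<noteq> 0"
  proof
    assume "profile K c W w = 0"
    then have "AE y in K. c y * exp (- w / (2 * W y)) = 0"
      unfolding profile_def
      by (subst (asm) integral_nonneg_eq_0_iff_AE[OF profile_integrable[OF assms]])
        (auto simp: c_pos less_imp_le)
    then have "AE y in K. False"
      by eventually_elim (use c_pos in \<open>simp add: less_imp_neq[symmetric]\<close>)
    then show False by simp
  qed
  with profile_nonneg[of w] show ?thesis by linarith
qed

lemma profile_antimono:
  assumes "0 < v" "v \<le> w"
  shows "profile K c W w \<le> profile K c W v"
  unfolding profile_def
proof (rule integral_mono)
  fix y
  have "- w / (2 * W y) \<le> - v / (2 * W y)"
    using W_pos[of y] assms by (simp add: divide_right_mono)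
  then show "c y * exp (- w / (2 * W y)) \<le> c y * exp (- v / (2 * W y))"
    by (intro mult_left_mono) (auto simp: c_pos less_imp_le)
qed (use assms in \<open>intro profile_integrable; linarith\<close>)+

text \<open>The logarithm of the integrand is affine in \<open>w\<close>, so the integrand at the
  interpolated point is the weighted geometric mean of those at \<open>u\<close> and
  \<open>v\<close>; Holder does the rest.\<close>

lemma profile_log_convex:
  assumes "0 < u" "0 < v" "0 \<le> t" "t \<le> 1"
  shows "profile K c W (t * u + (1 - t) * v) \<le> profile K c W u powr t * profile K c W v powr (1 - t)"
proof -
  let ?F = "\<lambda>w y. c y * exp (- w / (2 * W y))"
  have nn: "(\<integral>\<^sup>+y. ennreal (?F w y) \<partial>K) \<le> ennreal (profile K c W w)" if "0 < w" for w
    unfolding profile_def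
    by (subst nn_integral_eq_integral[OF profile_integrable[OF that]]) (auto simp: c_pos less_imp_le)
  have eq: "?F u y powr t * ?F v y powr (1 - t) = ?F (t * u + (1 - t) * v) y" for y
  proof -
    have "?F u y powr t * ?F v y powr (1 - t) =
        (c y powr t * c y powr (1 - t)) *
        (exp (- u / (2 * W y)) powr t * exp (- v / (2 * W y)) powr (1 - t))"
      using c_pos[of y] by (simp add: powr_mult ac_simps)
    also have "c y powr t * c y powr (1 - t) = c y"
      using c_pos[of y] by (simp add: powr_add[symmetric])
    also have "exp (- u / (2 * W y)) powr t * exp (- v / (2 * W y)) powr (1 - t) =
        exp (t * (- u / (2 * W y)) + (1 - t) * (- v / (2 * W y)))"
      by (simp add: powr_def mult_exp_exp)
    also have "t * (- u / (2 * W y)) + (1 - t) * (- v / (2 * W y)) = - (t * u + (1 - t) * v) / (2 * W y)"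
      using W_pos[of y] by (simp add: field_simps)
    finally show ?thesis .
  qed
  have "(\<integral>\<^sup>+y. ennreal (?F u y powr t * ?F v y powr (1 - t)) \<partial>K) \<le>
      ennreal (profile K c W u powr t * profile K c W v powr (1 - t))"
    using assms by (intro nn_integral_Holder nn profile_pos) (auto simp: c_pos less_imp_le)
  then show ?thesis
    unfolding eq profile_def[of K c W "t * u + (1 - t) * v"]
    by (intro integral_real_bounded) auto
qed

text \<open>The value at \<open>0\<close> is a junk value when the integral diverges; allowing
  \<open>u = v = 0\<close> lets the inequality be used pointwise under the law of \<open>W y * z\<^sup>2\<close>.\<close>

lemma profile_log_convex':
  assumes "0 < u \<and> 0 < v \<or> u = 0 \<and> v = 0" "0 \<le> t" "t \<le> 1"
  shows "profile K c W (t * u + (1 - t) * v) \<le> profile K c W u powr t * profile K c W v powr (1 - t)"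
proof (cases "0 < u")
  case True
  with assms show ?thesis by (intro profile_log_convex) auto
next
  case False
  with assms have "u = 0" "v = 0" by auto
  then show ?thesis
    using profile_nonneg[of 0] by (simp add: powr_add[symmetric])
qed

end

section \<open>The density of a Gaussian mixture with random variance \<open>W\<close>\<close>

locale gaussian_mixing = prob_space K for K :: "'b measure" +
  fixes W :: "'b \<Rightarrow> real"
  assumes W_measurable' [measurable]: "W \<in> borel_measurable K"
    and W_pos': "0 < W y"
begin

sublocale mixing_weight K "\<lambda>y. gauss_weight (W y)" W
  by unfold_locales (auto simp: W_pos' gauss_weight_pos)

definition dens :: "real \<Rightarrow> real" where
  "dens x = profile K (\<lambda>y. gauss_weight (W y)) W (x\<^sup>2)"

lemma dens_measurable [measurable]: "dens \<in> borel_measurable borel"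
  unfolding dens_def by measurable

lemma dens_nonneg: "0 \<le> dens x"
  by (simp add: dens_def profile_nonneg)

lemma dens_pos: "x \<noteq> 0 \<Longrightarrow> 0 < dens x"
  by (simp add: dens_def profile_pos)

text \<open>For fixed \<open>y\<close> the substitution \<open>x = sqrt (W y) * z\<close> produces
  the Gaussian density of variance \<open>W y\<close>; Tonelli then averages over
  \<open>y\<close>.\<close>

lemma distr_eq_density:
  "distr (K \<Otimes>\<^sub>M std_gaussian) borel (\<lambda>(y, z). sqrt (W y) * z) = density lborel (\<lambda>x. ennreal (dens x))"
proof (rule measure_eqI)
  fix A assume "A \<in> sets (distr (K \<Otimes>\<^sub>M std_gaussian) borel (\<lambda>(y, z). sqrt (W y) * z))"
  then have [measurable]: "A \<in> sets borel" by simp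
  interpret G: prob_space std_gaussian by (rule prob_space_std_gaussian)
  interpret KL: pair_sigma_finite K lborel ..
  have scale: "(\<integral>\<^sup>+z. indicator A (sqrt (W y) * z) \<partial>std_gaussian) =
      (\<integral>\<^sup>+x. ennreal (gauss_weight (W y) * exp (- x\<^sup>2 / (2 * W y))) * indicator A x \<partial>lborel)" for y
  proof -
    define s where "s = sqrt (W y)"
    have s: "0 < s" "W y = s\<^sup>2" using W_pos'[of y] by (auto simp: s_def)
    have "(\<integral>\<^sup>+x. ennreal (gauss_weight (W y) * exp (- x\<^sup>2 / (2 * W y))) * indicator A x \<partial>lborel) =
        ennreal s * (\<integral>\<^sup>+z. ennreal (gauss_weight (W y) * exp (- (s * z)\<^sup>2 / (2 * W y))) * indicator A (s * z) \<partial>lborel)"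
      using s by (subst nn_integral_real_affine[where c = s and t = 0]) auto
    also have "\<dots> = (\<integral>\<^sup>+z. ennreal (std_normal_density z) * indicator A (s * z) \<partial>lborel)"
    proof (subst nn_integral_cmult[symmetric])
      show "(\<integral>\<^sup>+z. ennreal s * (ennreal (gauss_weight (W y) * exp (- (s * z)\<^sup>2 / (2 * W y))) * indicator A (s * z)) \<partial>lborel) =
          (\<integral>\<^sup>+z. ennreal (std_normal_density z) * indicator A (s * z) \<partial>lborel)"
      proof (rule nn_integral_cong)
        fix z
        have "s * (gauss_weight (W y) * exp (- (s * z)\<^sup>2 / (2 * W y))) = std_normal_density z"
          using s by (simp add: gauss_weight_def std_normal_density_def real_sqrt_mult power_mult_distrib)
        moreover have "0 \<le> gauss_weight (W y) * exp (- (s * z)\<^sup>2 / (2 * W y))"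
          using W_pos'[of y] by (simp add: gauss_weight_def)
        ultimately show "ennreal s * (ennreal (gauss_weight (W y) * exp (- (s * z)\<^sup>2 / (2 * W y))) * indicator A (s * z)) =
            ennreal (std_normal_density z) * indicator A (s * z)"
          using s by (simp add: ennreal_mult[symmetric] mult.assoc[symmetric] del: std_normal_density_def)
      qed
    qed measurable
    also have "\<dots> = (\<integral>\<^sup>+z. indicator A (s * z) \<partial>std_gaussian)"
      unfolding std_gaussian_def by (subst nn_integral_density) auto
    finally show ?thesis by (simp add: s_def)
  qed
  have "emeasure (distr (K \<Otimes>\<^sub>M std_gaussian) borel (\<lambda>(y, z). sqrt (W y) * z)) A =
      (\<integral>\<^sup>+x. indicator A x \<partial>distr (K \<Otimes>\<^sub>M std_gaussian) borel (\<lambda>(y, z). sqrt (W y) * z))"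
    by simp
  also have "\<dots> = (\<integral>\<^sup>+x. indicator A (case x of (y, z) \<Rightarrow> sqrt (W y) * z) \<partial>(K \<Otimes>\<^sub>M std_gaussian))"
    by (subst nn_integral_distr) auto
  also have "\<dots> = (\<integral>\<^sup>+y. \<integral>\<^sup>+z. indicator A (sqrt (W y) * z) \<partial>std_gaussian \<partial>K)"
    by (subst G.nn_integral_fst[symmetric]) auto
  also have "\<dots> = (\<integral>\<^sup>+y. \<integral>\<^sup>+x. ennreal (gauss_weight (W y) * exp (- x\<^sup>2 / (2 * W y))) * indicator A x \<partial>lborel \<partial>K)"
    by (simp only: scale)
  also have "\<dots> = (\<integral>\<^sup>+x. \<integral>\<^sup>+y. ennreal (gauss_weight (W y) * exp (- x\<^sup>2 / (2 * W y))) * indicator A x \<partial>K \<partial>lborel)"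
    by (rule KL.Fubini'[symmetric]) measurable
  also have "\<dots> = (\<integral>\<^sup>+x. ennreal (dens x) * indicator A x \<partial>lborel)"
  proof (rule nn_integral_cong_AE)
    \<comment> \<open>At \<open>x = 0\<close> the integral over \<open>y\<close> can be infinite
      while \<open>dens 0\<close> is then a default value; a single point is null.\<close>
    have "AE x in lborel. x \<noteq> (0::real)" by (rule AE_lborel_singleton)
    then show "AE x in lborel. (\<integral>\<^sup>+y. ennreal (gauss_weight (W y) * exp (- x\<^sup>2 / (2 * W y))) * indicator A x \<partial>K) =
        ennreal (dens x) * indicator A x"
    proof eventually_elim
      case (elim x)
      then have "(\<integral>\<^sup>+y. ennreal (gauss_weight (W y) * exp (- x\<^sup>2 / (2 * W y))) \<partial>K) = ennreal (dens x)"
        unfolding dens_def profile_def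
        by (intro nn_integral_eq_integral profile_integrable) (auto simp: c_pos less_imp_le)
      then show ?case
        by (simp add: nn_integral_multc)
    qed
  qed
  also have "\<dots> = emeasure (density lborel (\<lambda>x. ennreal (dens x))) A"
    by (simp add: emeasure_density)
  finally show "emeasure (distr (K \<Otimes>\<^sub>M std_gaussian) borel (\<lambda>(y, z). sqrt (W y) * z)) A =
      emeasure (density lborel (\<lambda>x. ennreal (dens x))) A" .
qed simp

lemma AE_law_density:
  "AE x in lborel. law_density (distr (K \<Otimes>\<^sub>M std_gaussian) borel (\<lambda>(y, z). sqrt (W y) * z)) x = dens x"
proof -
  have "AE x in lborel. ennreal (dens x) = RN_deriv lborel (density lborel (\<lambda>x. ennreal (dens x))) x"
    by (rule sigma_finite_measure.RN_deriv_unique[OF sigma_finite_lborel]) auto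
  then show ?thesis
    unfolding distr_eq_density law_density_def
    by eventually_elim (metis dens_nonneg enn2real_ennreal)
qed

text \<open>An integral against the density becomes an integral over
  \<open>K \<Otimes>\<^sub>M std_gaussian\<close>, a space that does not depend on \<open>W\<close>.
  Integrals against different densities can thus be compared pointwise in
  \<open>(y, z)\<close>.\<close>

lemma nn_integral_square_mixture:
  assumes [measurable]: "k \<in> borel_measurable borel"
  shows "(\<integral>\<^sup>+x. k (W (fst x) * (snd x)\<^sup>2) \<partial>(K \<Otimes>\<^sub>M std_gaussian)) =
    (\<integral>\<^sup>+x. ennreal (dens x) * k (x\<^sup>2) \<partial>lborel)"
proof -
  have "(\<integral>\<^sup>+x. k (W (fst x) * (snd x)\<^sup>2) \<partial>(K \<Otimes>\<^sub>M std_gaussian)) =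
      (\<integral>\<^sup>+x. k ((case x of (y, z) \<Rightarrow> sqrt (W y) * z)\<^sup>2) \<partial>(K \<Otimes>\<^sub>M std_gaussian))"
    by (intro nn_integral_cong)
      (auto simp: power_mult_distrib real_sqrt_pow2 W_pos' less_imp_le split: prod.split)
  also have "\<dots> = (\<integral>\<^sup>+x. k (x\<^sup>2) \<partial>distr (K \<Otimes>\<^sub>M std_gaussian) borel (\<lambda>(y, z). sqrt (W y) * z))"
    by (subst nn_integral_distr) auto
  also have "\<dots> = (\<integral>\<^sup>+x. ennreal (dens x) * k (x\<^sup>2) \<partial>lborel)"
    unfolding distr_eq_density by (subst nn_integral_density) auto
  finally show ?thesis .
qed

lemma
  fixes k :: "real \<Rightarrow> real"
  assumes [measurable]: "k \<in> borel_measurable borel"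
  shows integral_square_mixture: "(LINT x|(K \<Otimes>\<^sub>M std_gaussian). k (W (fst x) * (snd x)\<^sup>2)) =
      (LINT x|lborel. dens x * k (x\<^sup>2))"
    and integrable_square_mixture: "integrable (K \<Otimes>\<^sub>M std_gaussian) (\<lambda>x. k (W (fst x) * (snd x)\<^sup>2)) \<longleftrightarrow>
      integrable lborel (\<lambda>x. dens x * k (x\<^sup>2))"
proof -
  have eq: "k (W (fst x) * (snd x)\<^sup>2) = k ((case x of (y, z) \<Rightarrow> sqrt (W y) * z)\<^sup>2)" for x
    by (auto simp: power_mult_distrib real_sqrt_pow2 W_pos' less_imp_le split: prod.split)
  show "(LINT x|(K \<Otimes>\<^sub>M std_gaussian). k (W (fst x) * (snd x)\<^sup>2)) = (LINT x|lborel. dens x * k (x\<^sup>2))"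
    unfolding eq
    by (subst integral_distr[where N = borel and f = "\<lambda>x. k (x\<^sup>2)", symmetric])
      (auto simp: distr_eq_density integral_real_density dens_nonneg)
  show "integrable (K \<Otimes>\<^sub>M std_gaussian) (\<lambda>x. k (W (fst x) * (snd x)\<^sup>2)) \<longleftrightarrow>
      integrable lborel (\<lambda>x. dens x * k (x\<^sup>2))"
    unfolding eq
    by (subst integrable_distr_eq[where N = borel and f = "\<lambda>x. k (x\<^sup>2)", symmetric])
      (auto simp: distr_eq_density integrable_real_density dens_nonneg)
qed

lemma nn_integral_dens: "(\<integral>\<^sup>+x. ennreal (dens x) \<partial>lborel) = 1"
proof -
  interpret G: prob_space std_gaussian by (rule prob_space_std_gaussian)
  interpret KG: pair_prob_space K std_gaussian ..
  show ?thesis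
    using nn_integral_square_mixture[of "\<lambda>_. 1"] by (simp add: KG.emeasure_space_1)
qed

end

section \<open>Shannon entropy\<close>

abbreviation (input) mixture_law :: "'b measure \<Rightarrow> ('b \<Rightarrow> real) \<Rightarrow> real measure" where
  "mixture_law K W \<equiv> distr (K \<Otimes>\<^sub>M std_gaussian) borel (\<lambda>(y, z). sqrt (W y) * z)"

context gaussian_mixing
begin

text \<open>Otherwise the density would vanish almost everywhere, against its total mass one. This
  keeps the logarithm in the Renyi entropy away from \<open>ln 0\<close>.\<close>

lemma nn_integral_dens_powr_nonzero: "(\<integral>\<^sup>+x. ennreal (dens x powr \<alpha>) \<partial>lborel) \<noteq> 0"
proof
  assume "(\<integral>\<^sup>+x. ennreal (dens x powr \<alpha>) \<partial>lborel) = 0"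
  then have "AE x in lborel. ennreal (dens x) = 0"
    by (subst (asm) nn_integral_0_iff_AE) (auto simp: ennreal_eq_0_iff elim!: eventually_mono)
  then have "(\<integral>\<^sup>+x. ennreal (dens x) \<partial>lborel) = 0"
    by (subst nn_integral_0_iff_AE) auto
  then show False
    using nn_integral_dens by simp
qed

lemma renyi_entropy_mixture:
  assumes "1 < \<alpha>"
  defines "I \<equiv> \<integral>\<^sup>+x. ennreal (dens x powr \<alpha>) \<partial>lborel"
  shows "renyi_entropy \<alpha> (mixture_law K W) =
    (if I = \<infinity> then - \<infinity> else ereal (ln (enn2real I) / (1 - \<alpha>)))"
proof -
  have "(\<integral>\<^sup>+x. ennreal (law_density (mixture_law K W) x powr \<alpha>) \<partial>lborel) = I"
    unfolding I_def by (rule nn_integral_cong_AE) (use AE_law_density in eventually_elim, simp)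
  then show ?thesis
    using assms by (simp add: renyi_entropy_def Let_def)
qed

lemma shannon_entropy_mixture:
  "renyi_entropy 1 (mixture_law K W) =
    enn2ereal (\<integral>\<^sup>+x. ennreal (- (dens x * ln (dens x))) \<partial>lborel) -
    enn2ereal (\<integral>\<^sup>+x. ennreal (dens x * ln (dens x)) \<partial>lborel)"
proof -
  have eq: "ennreal (dens x * max 0 a) = ennreal (dens x * a)" for x a
    using dens_nonneg[of x] by (auto simp: max_def ennreal_neg mult_nonneg_nonpos)
  have "(\<integral>\<^sup>+x. ennreal (law_density (mixture_law K W) x * max 0 (- ln (law_density (mixture_law K W) x))) \<partial>lborel) =
      (\<integral>\<^sup>+x. ennreal (- (dens x * ln (dens x))) \<partial>lborel)"
    by (rule nn_integral_cong_AE) (use AE_law_density in eventually_elim, simp add: eq)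
  moreover have "(\<integral>\<^sup>+x. ennreal (law_density (mixture_law K W) x * max 0 (ln (law_density (mixture_law K W) x))) \<partial>lborel) =
      (\<integral>\<^sup>+x. ennreal (dens x * ln (dens x)) \<partial>lborel)"
    by (rule nn_integral_cong_AE) (use AE_law_density in eventually_elim, simp add: eq)
  ultimately show ?thesis
    by (simp add: renyi_entropy_def Let_def)
qed

lemma integrable_dens: "integrable lborel dens"
  by (rule integrableI_nonneg) (auto simp: dens_nonneg nn_integral_dens)

lemma integral_dens: "(LINT x|lborel. dens x) = 1"
  by (rule integral_eq_nn_integral[THEN trans]) (auto simp: dens_nonneg nn_integral_dens)

end

text \<open>This is \<open>ln u \<le> u - 1\<close> at \<open>u = b / a\<close>, multiplied by
  \<open>a\<close>.\<close>

lemma gibbs_pointwise: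
  fixes a b :: real
  assumes "0 < a" "0 < b"
  shows "a * ln b \<le> a * ln a + b - a"
proof -
  have "ln (b / a) \<le> b / a - 1"
    using assms by (intro ln_le_minus_one) auto
  then have "a * (ln b - ln a) \<le> a * (b / a - 1)"
    using assms by (intro mult_left_mono) (auto simp: ln_div)
  then show ?thesis
    using assms by (simp add: algebra_simps)
qed

text \<open>Since \<open>ennreal\<close> cuts off negative values, the integrals are those of
  positive parts: finiteness passes from \<open>g\<close> and \<open>h\<close> to \<open>f\<close>
  without any control of negative parts.\<close>

lemma nn_integral_lincomb_finite:
  fixes f g h :: "'a \<Rightarrow> real"
  assumes [measurable]: "g \<in> borel_measurable M" "h \<in> borel_measurable M"
    and le: "AE x in M. f x \<le> a * g x + b * h x" and ab: "0 \<le> a" "0 \<le> b"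
    and fin: "(\<integral>\<^sup>+x. ennreal (g x) \<partial>M) \<noteq> \<infinity>" "(\<integral>\<^sup>+x. ennreal (h x) \<partial>M) \<noteq> \<infinity>"
  shows "(\<integral>\<^sup>+x. ennreal (f x) \<partial>M) \<noteq> \<infinity>"
proof -
  have "(\<integral>\<^sup>+x. ennreal (f x) \<partial>M) \<le>
      (\<integral>\<^sup>+x. ennreal a * ennreal (g x) + ennreal b * ennreal (h x) \<partial>M)"
  proof (rule nn_integral_mono_AE, use le in eventually_elim)
    case (elim x)
    have "f x \<le> a * max 0 (g x) + b * max 0 (h x)"
      using elim ab by (smt (verit) max.cobounded2 mult_left_mono)
    then have "ennreal (f x) \<le> ennreal (a * max 0 (g x) + b * max 0 (h x))"
      by (rule ennreal_leI)
    also have "\<dots> = ennreal a * ennreal (g x) + ennreal b * ennreal (h x)"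
      using ab by (simp add: ennreal_mult' ennreal_max_0)
    finally show ?case .
  qed
  also have "\<dots> = ennreal a * (\<integral>\<^sup>+x. ennreal (g x) \<partial>M) + ennreal b * (\<integral>\<^sup>+x. ennreal (h x) \<partial>M)"
    by (simp add: nn_integral_add nn_integral_cmult)
  also have "\<dots> < \<infinity>"
    using fin by (simp add: ennreal_mult_less_top less_top)
  finally show ?thesis by simp
qed

text \<open>In the instances \<open>W\<close> is an interpolated variance, \<open>V\<close> one of
  its endpoints and \<open>s\<close> the weight of that endpoint. Finiteness is passed from the
  interpolation to the endpoint.\<close>

locale dominated_mixings = A: gaussian_mixing K V + B: gaussian_mixing K W
  for K :: "'b measure" and V W :: "'b \<Rightarrow> real" +
  fixes s :: real
  assumes s_pos: "0 < s" and dominated: "s * V y \<le> W y"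
begin

text \<open>Gibbs' inequality against the (unnormalised) density \<open>x \<mapsto> B.dens (sqrt s * x)\<close>, which at a
  point of the law of \<open>V\<close> dominates \<open>B.dens\<close> at the coupled point of the law of \<open>W\<close>.\<close>

lemma entropy_finite:
  assumes fin: "(\<integral>\<^sup>+x. ennreal (- (B.dens x * ln (B.dens x))) \<partial>lborel) \<noteq> \<infinity>"
  shows "(\<integral>\<^sup>+x. ennreal (- (A.dens x * ln (A.dens x))) \<partial>lborel) \<noteq> \<infinity>"
proof -
  define G where "G = profile K (\<lambda>y. gauss_weight (W y)) W"
  have [measurable]: "G \<in> borel_measurable borel"
    unfolding G_def by (rule B.profile_measurable)
  define \<phi> where "\<phi> x = B.dens (sqrt s * x)" for x
  have \<phi>: "\<phi> x = G (s * x\<^sup>2)" for x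
    using s_pos by (simp add: \<phi>_def B.dens_def G_def power_mult_distrib)
  have [measurable]: "\<phi> \<in> borel_measurable borel"
    unfolding \<phi>_def by measurable
  have \<phi>_pos: "0 < \<phi> x" if "x \<noteq> 0" for x
    using that s_pos by (simp add: \<phi>_def B.dens_pos)
  \<comment> \<open>Rescaling by \<open>sqrt s\<close> gives \<open>\<phi>\<close> the total mass
    \<open>1 / sqrt s\<close>.\<close>
  have \<phi>_fin: "(\<integral>\<^sup>+x. ennreal (\<phi> x) \<partial>lborel) \<noteq> \<infinity>"
  proof -
    have "1 = ennreal (sqrt s) * (\<integral>\<^sup>+x. ennreal (\<phi> x) \<partial>lborel)"
      using s_pos B.nn_integral_dens
      by (subst (asm) nn_integral_real_affine[where c = "sqrt s" and t = 0]) (auto simp: \<phi>_def)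
    then show ?thesis
      using s_pos by (auto simp: ennreal_mult_top)
  qed
  have "(\<integral>\<^sup>+x. ennreal (A.dens x * max 0 (- ln (\<phi> x))) \<partial>lborel) =
      (\<integral>\<^sup>+x. ennreal (A.dens x) * ennreal (- ln (G (s * x\<^sup>2))) \<partial>lborel)"
    by (intro nn_integral_cong) (simp add: ennreal_mult' A.dens_nonneg \<phi> ennreal_max_0)
  also have "\<dots> = (\<integral>\<^sup>+x. ennreal (- ln (G (s * (V (fst x) * (snd x)\<^sup>2)))) \<partial>(K \<Otimes>\<^sub>M std_gaussian))"
    by (rule A.nn_integral_square_mixture[symmetric]) measurable
  also have "\<dots> \<le> (\<integral>\<^sup>+x. ennreal (- ln (G (W (fst x) * (snd x)\<^sup>2))) \<partial>(K \<Otimes>\<^sub>M std_gaussian))"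
  proof (intro nn_integral_mono ennreal_leI)
    fix x :: "'b \<times> real"
    \<comment> \<open>By \<open>dominated\<close> the argument for \<open>W\<close> is the larger
      one, and \<open>G\<close> decreases. At \<open>z = 0\<close> both arguments are
      \<open>0\<close>, so a default value of \<open>G 0\<close> does no harm.\<close>
    show "- ln (G (s * (V (fst x) * (snd x)\<^sup>2))) \<le> - ln (G (W (fst x) * (snd x)\<^sup>2))"
    proof (cases "snd x = 0")
      case False
      have pos: "0 < s * (V (fst x) * (snd x)\<^sup>2)" "0 < W (fst x) * (snd x)\<^sup>2"
        using False s_pos A.W_pos' B.W_pos' by auto
      have "s * (V (fst x) * (snd x)\<^sup>2) \<le> W (fst x) * (snd x)\<^sup>2"
        using dominated[of "fst x"] by (simp add: mult.assoc[symmetric] mult_right_mono)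
      then have "G (W (fst x) * (snd x)\<^sup>2) \<le> G (s * (V (fst x) * (snd x)\<^sup>2))"
        unfolding G_def using pos by (intro B.profile_antimono)
      then show ?thesis
        using B.profile_pos pos by (simp add: G_def)
    qed simp
  qed
  also have "\<dots> = (\<integral>\<^sup>+x. ennreal (B.dens x) * ennreal (- ln (G (x\<^sup>2))) \<partial>lborel)"
    by (rule B.nn_integral_square_mixture) measurable
  also have "\<dots> = (\<integral>\<^sup>+x. ennreal (- (B.dens x * ln (B.dens x))) \<partial>lborel)"
    by (simp add: ennreal_mult'[symmetric] B.dens_nonneg) (simp add: G_def B.dens_def)
  finally have cross: "(\<integral>\<^sup>+x. ennreal (A.dens x * max 0 (- ln (\<phi> x))) \<partial>lborel) \<noteq> \<infinity>"
    using fin by (auto simp: top_unique)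
  \<comment> \<open>Gibbs' inequality at \<open>b = \<phi> x\<close>, solved for the entropy
    integrand and with \<open>- A.dens x\<close> dropped. Only finite mass of \<open>\<phi>\<close>
    is needed, not mass one.\<close>
  have "AE x in lborel. - (A.dens x * ln (A.dens x)) \<le> 1 * (A.dens x * max 0 (- ln (\<phi> x))) + 1 * \<phi> x"
    using AE_lborel_singleton[of "0::real"]
  proof eventually_elim
    case (elim x)
    have "A.dens x * ln (\<phi> x) \<le> A.dens x * ln (A.dens x) + \<phi> x - A.dens x"
      using elim by (intro gibbs_pointwise A.dens_pos \<phi>_pos)
    moreover have "A.dens x * - ln (\<phi> x) \<le> A.dens x * max 0 (- ln (\<phi> x))"
      by (intro mult_left_mono) (auto simp: A.dens_nonneg)
    ultimately show ?case
      using A.dens_nonneg[of x] by simp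
  qed
  then show ?thesis
    by (rule nn_integral_lincomb_finite[rotated 2]) (use cross \<phi>_fin in auto)
qed

end

locale mixing_pair = A: gaussian_mixing K V + B: gaussian_mixing K W
  for K :: "'b measure" and V W :: "'b \<Rightarrow> real"
begin

lemma AE_gibbs:
  "AE x in lborel. A.dens x * ln (B.dens x) \<le> A.dens x * ln (A.dens x) + B.dens x - A.dens x"
  using AE_lborel_singleton[of "0::real"]
  by eventually_elim (intro gibbs_pointwise A.dens_pos B.dens_pos)

text \<open>Gibbs' inequality dominates the cross term by the term on the left of the assumption
  plus the integrable \<open>B.dens\<close>. Only positive parts are concerned.\<close>

lemma cross_log_finite:
  assumes "(\<integral>\<^sup>+x. ennreal (A.dens x * ln (A.dens x)) \<partial>lborel) \<noteq> \<infinity>"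
  shows "(\<integral>\<^sup>+x. ennreal (A.dens x * ln (B.dens x)) \<partial>lborel) \<noteq> \<infinity>"
proof (rule nn_integral_lincomb_finite[where a = 1 and b = 1])
  show "AE x in lborel. A.dens x * ln (B.dens x) \<le> 1 * (A.dens x * ln (A.dens x)) + 1 * B.dens x"
    using AE_gibbs by eventually_elim (use A.dens_nonneg in \<open>smt (verit)\<close>)
qed (use assms B.nn_integral_dens in auto)

text \<open>Both densities have mass one, so the terms \<open>B.dens x - A.dens x\<close> of the
  pointwise inequality integrate to zero.\<close>

lemma gibbs:
  assumes "integrable lborel (\<lambda>x. A.dens x * ln (A.dens x))"
    and "integrable lborel (\<lambda>x. A.dens x * ln (B.dens x))"
  shows "(LINT x|lborel. A.dens x * ln (B.dens x)) \<le> (LINT x|lborel. A.dens x * ln (A.dens x))"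
proof -
  have "(LINT x|lborel. A.dens x * ln (B.dens x)) \<le>
      (LINT x|lborel. A.dens x * ln (A.dens x) + B.dens x - A.dens x)"
    using assms A.integrable_dens B.integrable_dens AE_gibbs by (intro integral_mono_AE) auto
  also have "\<dots> = (LINT x|lborel. A.dens x * ln (A.dens x))"
    using assms A.integrable_dens B.integrable_dens A.integral_dens B.integral_dens by simp
  finally show ?thesis .
qed

end

section \<open>Interpolation between two mixing variances\<close>

locale mixing_interpolation = P: gaussian_mixing K P + Q: gaussian_mixing K Q
  for K :: "'b measure" and P Q :: "'b \<Rightarrow> real" +
  fixes t :: real
  assumes t_pos: "0 < t" and t_less: "t < 1"
begin

sublocale R: gaussian_mixing K "\<lambda>y. t * P y + (1 - t) * Q y"
  by unfold_locales (use t_pos t_less P.W_pos' Q.W_pos' in \<open>auto intro!: add_pos_pos mult_pos_pos\<close>)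

sublocale PR: mixing_pair K P "\<lambda>y. t * P y + (1 - t) * Q y" ..

sublocale QR: mixing_pair K Q "\<lambda>y. t * P y + (1 - t) * Q y" ..

sublocale tPR: dominated_mixings K P "\<lambda>y. t * P y + (1 - t) * Q y" t
  by unfold_locales (use t_pos t_less Q.W_pos' in \<open>auto simp: less_imp_le\<close>)

sublocale tQR: dominated_mixings K Q "\<lambda>y. t * P y + (1 - t) * Q y" "1 - t"
  by unfold_locales (use t_pos t_less P.W_pos' in \<open>auto simp: less_imp_le\<close>)

text \<open>For fixed \<open>y\<close> and \<open>z\<close> the first argument is the convex
  combination of the other two, and one and the same profile is evaluated at all three. The
  arguments are all positive or, at \<open>z = 0\<close>, all zero.\<close>

lemma log_convex_at_square:
  assumes "mixing_weight K c W"
  shows "profile K c W ((t * P y + (1 - t) * Q y) * z\<^sup>2) \<le>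
    profile K c W (P y * z\<^sup>2) powr t * profile K c W (Q y * z\<^sup>2) powr (1 - t)"
proof -
  interpret mixing_weight K c W by fact
  have "(t * P y + (1 - t) * Q y) * z\<^sup>2 = t * (P y * z\<^sup>2) + (1 - t) * (Q y * z\<^sup>2)"
    by (simp add: algebra_simps)
  moreover have "0 < P y * z\<^sup>2 \<and> 0 < Q y * z\<^sup>2 \<or> P y * z\<^sup>2 = 0 \<and> Q y * z\<^sup>2 = 0"
    using P.W_pos'[of y] Q.W_pos'[of y] by (cases "z = 0") auto
  ultimately show ?thesis
    using t_pos t_less profile_log_convex' by simp
qed

text \<open>The delicate point is integrability. For the logarithm of the density of
  \<open>R\<close> at the three coupled points, the positive parts at the endpoints are finite by
  Gibbs and the negative part at \<open>R\<close> by assumption; the convexity inequality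
  \<open>conv\<close> then makes the remaining three parts finite.\<close>

lemma shannon_interpolation:
  assumes nR: "(\<integral>\<^sup>+x. ennreal (- (R.dens x * ln (R.dens x))) \<partial>lborel) \<noteq> \<infinity>"
    and pP: "(\<integral>\<^sup>+x. ennreal (P.dens x * ln (P.dens x)) \<partial>lborel) \<noteq> \<infinity>"
    and pQ: "(\<integral>\<^sup>+x. ennreal (Q.dens x * ln (Q.dens x)) \<partial>lborel) \<noteq> \<infinity>"
  shows "integrable lborel (\<lambda>x. P.dens x * ln (P.dens x))"
    and "integrable lborel (\<lambda>x. Q.dens x * ln (Q.dens x))"
    and "integrable lborel (\<lambda>x. R.dens x * ln (R.dens x))"
    and "(LINT x|lborel. R.dens x * ln (R.dens x)) \<le>
      t * (LINT x|lborel. P.dens x * ln (P.dens x)) + (1 - t) * (LINT x|lborel. Q.dens x * ln (Q.dens x))"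
proof -
  show iP: "integrable lborel (\<lambda>x. P.dens x * ln (P.dens x))"
    using tPR.entropy_finite[OF nR] pP by (simp add: real_integrable_def)
  show iQ: "integrable lborel (\<lambda>x. Q.dens x * ln (Q.dens x))"
    using tQR.entropy_finite[OF nR] pQ by (simp add: real_integrable_def)
  let ?R = "\<lambda>y. t * P y + (1 - t) * Q y"
  let ?\<rho> = "K \<Otimes>\<^sub>M std_gaussian"
  define L where "L w = ln (profile K (\<lambda>y. gauss_weight (?R y)) ?R w)" for w
  have [measurable]: "L \<in> borel_measurable borel"
    unfolding L_def using R.profile_measurable by measurable
  have L: "ln (R.dens x) = L (x\<^sup>2)" for x
    by (simp add: L_def R.dens_def)
  define a b c where "a x = L (?R (fst x) * (snd x)\<^sup>2)" and "b x = L (P (fst x) * (snd x)\<^sup>2)"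
    and "c x = L (Q (fst x) * (snd x)\<^sup>2)" for x :: "'b \<times> real"
  have [measurable]: "a \<in> borel_measurable ?\<rho>" "b \<in> borel_measurable ?\<rho>" "c \<in> borel_measurable ?\<rho>"
    unfolding a_def b_def c_def by measurable
  have conv: "a x \<le> t * b x + (1 - t) * c x" for x
  proof (cases "snd x = 0")
    case True
    then show ?thesis by (simp add: a_def b_def c_def algebra_simps)
  next
    case False
    let ?G = "profile K (\<lambda>y. gauss_weight (?R y)) ?R"
    have pos: "0 < ?G (P (fst x) * (snd x)\<^sup>2)" "0 < ?G (Q (fst x) * (snd x)\<^sup>2)"
      "0 < ?G (?R (fst x) * (snd x)\<^sup>2)"
      using False P.W_pos' Q.W_pos' R.W_pos' by (auto intro!: R.profile_pos)
    have "a x \<le> ln (?G (P (fst x) * (snd x)\<^sup>2) powr t * ?G (Q (fst x) * (snd x)\<^sup>2) powr (1 - t))"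
      unfolding a_def L_def using pos log_convex_at_square[OF R.mixing_weight_axioms]
      by (intro ln_mono) auto
    also have "\<dots> = t * b x + (1 - t) * c x"
      using pos by (simp add: b_def c_def L_def ln_mult ln_powr)
    finally show ?thesis .
  qed
  have pb: "(\<integral>\<^sup>+x. ennreal (b x) \<partial>?\<rho>) \<noteq> \<infinity>"
    using P.nn_integral_square_mixture[of "\<lambda>w. ennreal (L w)"] PR.cross_log_finite[OF pP]
    by (simp add: b_def L ennreal_mult'[symmetric] P.dens_nonneg)
  have pc: "(\<integral>\<^sup>+x. ennreal (c x) \<partial>?\<rho>) \<noteq> \<infinity>"
    using Q.nn_integral_square_mixture[of "\<lambda>w. ennreal (L w)"] QR.cross_log_finite[OF pQ]
    by (simp add: c_def L ennreal_mult'[symmetric] Q.dens_nonneg)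
  have na: "(\<integral>\<^sup>+x. ennreal (- a x) \<partial>?\<rho>) \<noteq> \<infinity>"
    using R.nn_integral_square_mixture[of "\<lambda>w. ennreal (- L w)"] nR
    by (simp add: a_def L ennreal_mult'[symmetric] R.dens_nonneg)
  have pa: "(\<integral>\<^sup>+x. ennreal (a x) \<partial>?\<rho>) \<noteq> \<infinity>"
    using t_pos t_less pb pc conv by (intro nn_integral_lincomb_finite[of b _ c a t "1 - t"]) auto
  \<comment> \<open>Solving \<open>conv\<close> for \<open>- b x\<close> bounds it by a nonnegative
    combination of \<open>- a x\<close> and \<open>c x\<close>, whose positive parts are known to be
    finite; \<open>nc\<close> is symmetric.\<close>
  have nb: "(\<integral>\<^sup>+x. ennreal (- b x) \<partial>?\<rho>) \<noteq> \<infinity>"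
  proof (rule nn_integral_lincomb_finite[of "\<lambda>x. - a x" _ c _ "1 / t" "(1 - t) / t"])
    show "AE x in ?\<rho>. - b x \<le> 1 / t * - a x + (1 - t) / t * c x"
    proof (rule AE_I2)
      fix x
      have "- b x \<le> (- a x + (1 - t) * c x) / t"
        using conv[of x] t_pos by (simp add: pos_le_divide_eq mult.commute)
      also have "\<dots> = 1 / t * - a x + (1 - t) / t * c x"
        using t_pos by (simp add: field_simps)
      finally show "- b x \<le> 1 / t * - a x + (1 - t) / t * c x" .
    qed
  qed (use na pc t_pos t_less in auto)
  have nc: "(\<integral>\<^sup>+x. ennreal (- c x) \<partial>?\<rho>) \<noteq> \<infinity>"
  proof (rule nn_integral_lincomb_finite[of "\<lambda>x. - a x" _ b _ "1 / (1 - t)" "t / (1 - t)"])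
    show "AE x in ?\<rho>. - c x \<le> 1 / (1 - t) * - a x + t / (1 - t) * b x"
    proof (rule AE_I2)
      fix x
      have "- c x \<le> (- a x + t * b x) / (1 - t)"
        using conv[of x] t_less by (simp add: pos_le_divide_eq mult.commute)
      also have "\<dots> = 1 / (1 - t) * - a x + t / (1 - t) * b x"
        by (simp add: diff_divide_distrib)
      finally show "- c x \<le> 1 / (1 - t) * - a x + t / (1 - t) * b x" .
    qed
  qed (use na pb t_pos t_less in auto)
  have ia: "integrable ?\<rho> a" and ib: "integrable ?\<rho> b" and ic: "integrable ?\<rho> c"
    using pa na pb nb pc nc by (simp_all add: real_integrable_def)
  have ia': "integrable lborel (\<lambda>x. R.dens x * ln (R.dens x))"
    using ia unfolding a_def L by (subst (asm) R.integrable_square_mixture) auto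
  have ib': "integrable lborel (\<lambda>x. P.dens x * ln (R.dens x))"
    using ib unfolding b_def L by (subst (asm) P.integrable_square_mixture) auto
  have ic': "integrable lborel (\<lambda>x. Q.dens x * ln (R.dens x))"
    using ic unfolding c_def L by (subst (asm) Q.integrable_square_mixture) auto
  show "integrable lborel (\<lambda>x. R.dens x * ln (R.dens x))" by fact
  have "(LINT x|lborel. R.dens x * ln (R.dens x)) = (LINT x|?\<rho>. a x)"
    unfolding a_def L by (rule R.integral_square_mixture[symmetric]) measurable
  also have "\<dots> \<le> (LINT x|?\<rho>. t * b x + (1 - t) * c x)"
    using ia ib ic conv by (intro integral_mono) auto
  also have "\<dots> = t * (LINT x|?\<rho>. b x) + (1 - t) * (LINT x|?\<rho>. c x)"
    using ib ic by simp
  also have "(LINT x|?\<rho>. b x) = (LINT x|lborel. P.dens x * ln (R.dens x))"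
    unfolding b_def L by (rule P.integral_square_mixture) measurable
  also have "(LINT x|?\<rho>. c x) = (LINT x|lborel. Q.dens x * ln (R.dens x))"
    unfolding c_def L by (rule Q.integral_square_mixture) measurable
  also have "t * (LINT x|lborel. P.dens x * ln (R.dens x)) + (1 - t) * (LINT x|lborel. Q.dens x * ln (R.dens x)) \<le>
      t * (LINT x|lborel. P.dens x * ln (P.dens x)) + (1 - t) * (LINT x|lborel. Q.dens x * ln (Q.dens x))"
    using t_pos t_less by (intro add_mono mult_left_mono PR.gibbs QR.gibbs iP iQ ib' ic') auto
  finally show "(LINT x|lborel. R.dens x * ln (R.dens x)) \<le>
      t * (LINT x|lborel. P.dens x * ln (P.dens x)) + (1 - t) * (LINT x|lborel. Q.dens x * ln (Q.dens x))" .
qed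

end

section \<open>Renyi entropy\<close>

context gaussian_mixing
begin

text \<open>The level is \<open>Suc m\<close> and not \<open>m\<close>, so that the weight stays
  positive at \<open>m = 0\<close>.\<close>

lemma truncated_weight: "mixing_weight K (\<lambda>y. min (gauss_weight (W y)) (real (Suc m))) W"
  by unfold_locales (auto simp: W_pos' gauss_weight_pos)

lemma truncated_profile_le:
  assumes "0 \<le> w"
  shows "profile K (\<lambda>y. min (gauss_weight (W y)) (real (Suc m))) W w \<le> real (Suc m)"
  unfolding profile_def
proof (rule integral_real_bounded)
  have "(\<integral>\<^sup>+y. ennreal (min (gauss_weight (W y)) (real (Suc m)) * exp (- w / (2 * W y))) \<partial>K) \<le>
      (\<integral>\<^sup>+y. ennreal (real (Suc m)) \<partial>K)"
  proof (intro nn_integral_mono ennreal_leI)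
    fix y
    have "min (gauss_weight (W y)) (real (Suc m)) * exp (- w / (2 * W y)) \<le> real (Suc m) * 1"
      using assms W_pos'[of y] by (intro mult_mono) auto
    then show "min (gauss_weight (W y)) (real (Suc m)) * exp (- w / (2 * W y)) \<le> real (Suc m)"
      by simp
  qed
  then show "(\<integral>\<^sup>+y. ennreal (min (gauss_weight (W y)) (real (Suc m)) * exp (- w / (2 * W y))) \<partial>K) \<le>
      ennreal (real (Suc m))"
    by (simp add: emeasure_space_1)
qed simp

lemma truncated_profile_le_dens:
  assumes "x \<noteq> 0"
  shows "profile K (\<lambda>y. min (gauss_weight (W y)) (real (Suc m))) W (x\<^sup>2) \<le> dens x"
  unfolding dens_def profile_def
proof (rule integral_mono)
  show "integrable K (\<lambda>y. min (gauss_weight (W y)) (real (Suc m)) * exp (- x\<^sup>2 / (2 * W y)))"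
    using assms by (intro mixing_weight.profile_integrable[OF truncated_weight]) simp
  show "integrable K (\<lambda>y. gauss_weight (W y) * exp (- x\<^sup>2 / (2 * W y)))"
    using assms by (intro profile_integrable) simp
qed (auto intro!: mult_right_mono)

text \<open>For each \<open>y\<close> the truncation is inactive once \<open>m\<close> is large, and
  the untruncated integrand, integrable away from \<open>x = 0\<close>, dominates.\<close>

lemma truncated_profile_tendsto:
  assumes "x \<noteq> 0"
  shows "(\<lambda>m. profile K (\<lambda>y. min (gauss_weight (W y)) (real (Suc m))) W (x\<^sup>2)) \<longlonglongrightarrow> dens x"
  unfolding dens_def profile_def
proof (rule integral_dominated_convergence)
  show "integrable K (\<lambda>y. gauss_weight (W y) * exp (- x\<^sup>2 / (2 * W y)))"
    using assms by (intro profile_integrable) simp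
  show "AE y in K. (\<lambda>m. min (gauss_weight (W y)) (real (Suc m)) * exp (- x\<^sup>2 / (2 * W y)))
      \<longlonglongrightarrow> gauss_weight (W y) * exp (- x\<^sup>2 / (2 * W y))"
  proof (intro AE_I2 tendsto_mult tendsto_const tendsto_eventually)
    fix y
    obtain N where "gauss_weight (W y) \<le> real N"
      using real_arch_simple by blast
    then have "\<forall>m\<ge>N. min (gauss_weight (W y)) (real (Suc m)) = gauss_weight (W y)"
      by (auto simp: min_def)
    then show "\<forall>\<^sub>F m in sequentially. min (gauss_weight (W y)) (real (Suc m)) = gauss_weight (W y)"
      unfolding eventually_sequentially by blast
  qed
  show "AE y in K. norm (min (gauss_weight (W y)) (real (Suc m)) * exp (- x\<^sup>2 / (2 * W y)))
      \<le> gauss_weight (W y) * exp (- x\<^sup>2 / (2 * W y))" for m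
    using c_pos by (intro AE_I2) (auto intro!: mult_right_mono simp: less_imp_le)
qed measurable

end

context mixing_interpolation
begin

text \<open>Truncating the mixing weight keeps the profile log-convex and makes the quantity \<open>j\<close>
  below finite, so that it may be cancelled in \<open>j \<le> (A\<^sup>t B\<^sup>1\<^sup>-\<^sup>t)\<^sup>1\<^sup>/\<^sup>\<alpha> j\<^sup>1\<^sup>-\<^sup>1\<^sup>/\<^sup>\<alpha>\<close>.\<close>

lemma truncated_renyi_bound:
  fixes m :: nat
  assumes \<alpha>: "1 < \<alpha>"
    and A: "(\<integral>\<^sup>+x. ennreal (P.dens x powr \<alpha>) \<partial>lborel) \<le> ennreal A" "0 < A"
    and B: "(\<integral>\<^sup>+x. ennreal (Q.dens x powr \<alpha>) \<partial>lborel) \<le> ennreal B" "0 < B"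
  defines "G \<equiv> profile K (\<lambda>y. min (gauss_weight (t * P y + (1 - t) * Q y)) (real (Suc m)))
      (\<lambda>y. t * P y + (1 - t) * Q y)"
  shows "(\<integral>\<^sup>+x. ennreal (R.dens x) * ennreal (G (x\<^sup>2) powr (\<alpha> - 1)) \<partial>lborel) \<le>
    ennreal (A powr t * B powr (1 - t))"
proof -
  let ?R = "\<lambda>y. t * P y + (1 - t) * Q y"
  interpret N: mixing_weight K "\<lambda>y. min (gauss_weight (?R y)) (real (Suc m))" ?R
    by (rule R.truncated_weight)
  have [measurable]: "G \<in> borel_measurable borel"
    unfolding G_def by (rule N.profile_measurable)
  have G_nonneg: "0 \<le> G w" for w
    unfolding G_def by (rule N.profile_nonneg)
  define J where "J = (\<integral>\<^sup>+x. ennreal (R.dens x) * ennreal (G (x\<^sup>2) powr (\<alpha> - 1)) \<partial>lborel)"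
  have "J \<le> (\<integral>\<^sup>+x. ennreal (R.dens x) * ennreal (real (Suc m) powr (\<alpha> - 1)) \<partial>lborel)"
    unfolding J_def G_def using \<alpha>
    by (intro nn_integral_mono mult_left_mono ennreal_leI powr_mono2 N.profile_nonneg R.truncated_profile_le) auto
  also have "\<dots> = ennreal (real (Suc m) powr (\<alpha> - 1))"
    by (simp add: nn_integral_multc R.nn_integral_dens)
  finally have "J \<noteq> \<infinity>"
    by (auto simp: top_unique)
  then obtain j where j: "J = ennreal j" "0 \<le> j"
    by (cases J) auto
  show ?thesis
  proof (cases "j = 0")
    case True
    then show ?thesis using j by (simp add: J_def)
  next
    case False
    with j have jp: "0 < j" by simp
    define \<beta> where "\<beta> = 1 - 1 / \<alpha>"
    have \<beta>: "\<alpha> * \<beta> = \<alpha> - 1"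
      using \<alpha> by (simp add: \<beta>_def algebra_simps)
    \<comment> \<open>One factor \<open>G (x\<^sup>2)\<close> is replaced by the larger
      \<open>R.dens x\<close>, so the norm of \<open>G\<close> in Holder's inequality is controlled
      by \<open>J\<close> itself.\<close>
    have "(\<integral>\<^sup>+x. ennreal (G (x\<^sup>2) powr \<alpha>) \<partial>lborel) \<le> J"
      unfolding J_def
    proof (rule nn_integral_mono_AE, use AE_lborel_singleton[of "0::real"] in eventually_elim)
      case (elim x)
      have "G (x\<^sup>2) powr \<alpha> = G (x\<^sup>2) * G (x\<^sup>2) powr (\<alpha> - 1)"
        using G_nonneg[of "x\<^sup>2"] by (simp add: powr_mult_base)
      also have "\<dots> \<le> R.dens x * G (x\<^sup>2) powr (\<alpha> - 1)"
        using R.truncated_profile_le_dens[OF elim, of m] by (intro mult_right_mono) (auto simp: G_def)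
      finally show ?case
        by (simp add: ennreal_mult[symmetric] R.dens_nonneg)
    qed
    then have Gj: "(\<integral>\<^sup>+x. ennreal (G (x\<^sup>2) powr \<alpha>) \<partial>lborel) \<le> ennreal j"
      by (simp add: j)
    \<comment> \<open>Holder with the conjugate exponents \<open>\<alpha>\<close> and
      \<open>1 / \<beta>\<close>, to be used with \<open>f\<close> the density of \<open>P\<close>
      and of \<open>Q\<close>.\<close>
    have cross: "(\<integral>\<^sup>+x. ennreal (f x) * ennreal (G (x\<^sup>2) powr (\<alpha> - 1)) \<partial>lborel) \<le>
        ennreal (C powr (1 / \<alpha>) * j powr \<beta>)"
      if [measurable]: "f \<in> borel_measurable borel" and f: "\<And>x. 0 \<le> f x"
        and C: "(\<integral>\<^sup>+x. ennreal (f x powr \<alpha>) \<partial>lborel) \<le> ennreal C" "0 < C" for f :: "real \<Rightarrow> real" and C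
    proof -
      have "(\<integral>\<^sup>+x. ennreal (f x) * ennreal (G (x\<^sup>2) powr (\<alpha> - 1)) \<partial>lborel) =
          (\<integral>\<^sup>+x. ennreal ((f x powr \<alpha>) powr (1 / \<alpha>) * (G (x\<^sup>2) powr \<alpha>) powr (1 - 1 / \<alpha>)) \<partial>lborel)"
        using \<alpha> f \<beta> by (simp add: ennreal_mult powr_powr \<beta>_def)
      also have "\<dots> \<le> ennreal (C powr (1 / \<alpha>) * j powr \<beta>)"
        unfolding \<beta>_def using \<alpha> jp C Gj by (intro nn_integral_Holder) auto
      finally show ?thesis .
    qed
    let ?A' = "A powr (1 / \<alpha>) * j powr \<beta>" and ?B' = "B powr (1 / \<alpha>) * j powr \<beta>"
    \<comment> \<open>On the common space log-convexity of \<open>G\<close> applies at each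
      \<open>(y, z)\<close>; Holder with weights \<open>t\<close> and \<open>1 - t\<close> then
      separates the two endpoints.\<close>
    have "J = (\<integral>\<^sup>+x. ennreal (G (?R (fst x) * (snd x)\<^sup>2) powr (\<alpha> - 1)) \<partial>(K \<Otimes>\<^sub>M std_gaussian))"
      unfolding J_def by (rule R.nn_integral_square_mixture[symmetric]) measurable
    also have "\<dots> \<le> (\<integral>\<^sup>+x. ennreal ((G (P (fst x) * (snd x)\<^sup>2) powr (\<alpha> - 1)) powr t *
        (G (Q (fst x) * (snd x)\<^sup>2) powr (\<alpha> - 1)) powr (1 - t)) \<partial>(K \<Otimes>\<^sub>M std_gaussian))"
    proof (intro nn_integral_mono ennreal_leI)
      fix x :: "'b \<times> real"
      have "G (?R (fst x) * (snd x)\<^sup>2) powr (\<alpha> - 1) \<le>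
          (G (P (fst x) * (snd x)\<^sup>2) powr t * G (Q (fst x) * (snd x)\<^sup>2) powr (1 - t)) powr (\<alpha> - 1)"
        using \<alpha> log_convex_at_square[OF N.mixing_weight_axioms, of "fst x" "snd x"] G_nonneg
        by (intro powr_mono2) (auto simp: G_def)
      then show "G (?R (fst x) * (snd x)\<^sup>2) powr (\<alpha> - 1) \<le>
          (G (P (fst x) * (snd x)\<^sup>2) powr (\<alpha> - 1)) powr t *
          (G (Q (fst x) * (snd x)\<^sup>2) powr (\<alpha> - 1)) powr (1 - t)"
        using G_nonneg by (simp add: powr_mult powr_powr mult.commute)
    qed
    also have "\<dots> \<le> ennreal (?A' powr t * ?B' powr (1 - t))"
    proof (rule nn_integral_Holder)
      show "(\<integral>\<^sup>+x. ennreal (G (P (fst x) * (snd x)\<^sup>2) powr (\<alpha> - 1)) \<partial>(K \<Otimes>\<^sub>M std_gaussian)) \<le> ennreal ?A'"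
        using cross[OF P.dens_measurable P.dens_nonneg A]
        by (subst P.nn_integral_square_mixture) auto
      show "(\<integral>\<^sup>+x. ennreal (G (Q (fst x) * (snd x)\<^sup>2) powr (\<alpha> - 1)) \<partial>(K \<Otimes>\<^sub>M std_gaussian)) \<le> ennreal ?B'"
        using cross[OF Q.dens_measurable Q.dens_nonneg B]
        by (subst Q.nn_integral_square_mixture) auto
    qed (use A B jp t_pos t_less in auto)
    finally have "j \<le> ?A' powr t * ?B' powr (1 - t)"
      using j by (simp add: ennreal_le_iff)
    then have "ln j \<le> ln (?A' powr t * ?B' powr (1 - t))"
      using jp by (intro ln_mono) auto
    also have "\<dots> = t * (ln A / \<alpha> + \<beta> * ln j) + (1 - t) * (ln B / \<alpha> + \<beta> * ln j)"
      using A B jp by (simp add: ln_mult ln_powr)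
    also have "\<dots> = (t * ln A + (1 - t) * ln B) / \<alpha> + \<beta> * ln j"
      by (simp add: algebra_simps add_divide_distrib diff_divide_distrib)
    \<comment> \<open>The term \<open>\<beta> * ln j\<close> moves to the left, where
      \<open>1 - \<beta> = 1 / \<alpha>\<close> remains as coefficient.\<close>
    finally have "ln j / \<alpha> \<le> (t * ln A + (1 - t) * ln B) / \<alpha>"
      by (simp add: \<beta>_def algebra_simps)
    then have "ln j \<le> t * ln A + (1 - t) * ln B"
      using \<alpha> by (simp add: divide_le_cancel)
    also have "\<dots> = ln (A powr t * B powr (1 - t))"
      using A B by (simp add: ln_mult ln_powr)
    finally have "j \<le> A powr t * B powr (1 - t)"
      using A B jp by (subst (asm) ln_le_cancel_iff) auto
    then show ?thesis
      using j by (simp add: J_def[symmetric] ennreal_leI)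
  qed
qed

text \<open>The truncated bound does not depend on \<open>m\<close>, and the truncated profiles
  converge to the density away from \<open>0\<close>; Fatou's lemma removes the truncation.\<close>

lemma renyi_interpolation:
  assumes \<alpha>: "1 < \<alpha>"
    and A: "(\<integral>\<^sup>+x. ennreal (P.dens x powr \<alpha>) \<partial>lborel) \<le> ennreal A" "0 < A"
    and B: "(\<integral>\<^sup>+x. ennreal (Q.dens x powr \<alpha>) \<partial>lborel) \<le> ennreal B" "0 < B"
  shows "(\<integral>\<^sup>+x. ennreal (R.dens x powr \<alpha>) \<partial>lborel) \<le> ennreal (A powr t * B powr (1 - t))"
proof -
  let ?R = "\<lambda>y. t * P y + (1 - t) * Q y"
  define G where "G m = profile K (\<lambda>y. min (gauss_weight (?R y)) (real (Suc m))) ?R" for m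
  have [measurable]: "G m \<in> borel_measurable borel" for m
    unfolding G_def by (rule mixing_weight.profile_measurable[OF R.truncated_weight])
  let ?h = "\<lambda>m x. ennreal (R.dens x) * ennreal (G m (x\<^sup>2) powr (\<alpha> - 1))"
  have "(\<integral>\<^sup>+x. ennreal (R.dens x powr \<alpha>) \<partial>lborel) = (\<integral>\<^sup>+x. liminf (\<lambda>m. ?h m x) \<partial>lborel)"
  proof (rule nn_integral_cong_AE, use AE_lborel_singleton[of "0::real"] in eventually_elim)
    case (elim x)
    have "(\<lambda>m. R.dens x * G m (x\<^sup>2) powr (\<alpha> - 1)) \<longlonglongrightarrow> R.dens x * R.dens x powr (\<alpha> - 1)"
      using R.truncated_profile_tendsto[OF elim] R.dens_pos[OF elim]
      by (intro tendsto_intros) (auto simp: G_def)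
    then have "(\<lambda>m. ?h m x) \<longlonglongrightarrow> ennreal (R.dens x * R.dens x powr (\<alpha> - 1))"
      by (simp add: ennreal_mult[symmetric] R.dens_nonneg tendsto_ennrealI)
    then show ?case
      using lim_imp_Liminf[OF trivial_limit_sequentially, of "\<lambda>m. ?h m x"] R.dens_nonneg[of x]
      by (simp add: powr_mult_base)
  qed
  also have "\<dots> \<le> liminf (\<lambda>m. \<integral>\<^sup>+x. ?h m x \<partial>lborel)"
    by (rule nn_integral_liminf) measurable
  also have "\<dots> \<le> liminf (\<lambda>m. ennreal (A powr t * B powr (1 - t)))"
    unfolding G_def by (intro Liminf_mono always_eventually allI truncated_renyi_bound assms)
  also have "\<dots> = ennreal (A powr t * B powr (1 - t))"
    by (simp add: Liminf_const)
  finally show ?thesis .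
qed

text \<open>Pitfall: \<open>\<infinity> - x = \<infinity>\<close> in \<open>ereal\<close> for every \<open>x\<close>, even \<open>x = \<infinity>\<close>. So an entropy is \<open>\<infinity>\<close> as soon as
  its negative-logarithm part is, and \<open>entropy_finite\<close> is needed to exclude this for \<open>P\<close> and \<open>Q\<close>.\<close>

lemma shannon_entropy_concave:
  "ereal t * renyi_entropy 1 (mixture_law K P) + ereal (1 - t) * renyi_entropy 1 (mixture_law K Q) \<le>
   renyi_entropy 1 (mixture_law K (\<lambda>y. t * P y + (1 - t) * Q y))"
proof -
  note entropy = P.shannon_entropy_mixture Q.shannon_entropy_mixture R.shannon_entropy_mixture
  have lint: "enn2ereal (\<integral>\<^sup>+x. ennreal (- g x) \<partial>lborel) - enn2ereal (\<integral>\<^sup>+x. ennreal (g x) \<partial>lborel) =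
      ereal (- (LINT x|lborel. g x))" if "integrable lborel g" for g :: "real \<Rightarrow> real"
  proof -
    have "(\<integral>\<^sup>+x. ennreal (- g x) \<partial>lborel) \<noteq> \<infinity>" "(\<integral>\<^sup>+x. ennreal (g x) \<partial>lborel) \<noteq> \<infinity>"
      using that by (auto simp: real_integrable_def)
    then show ?thesis
      using real_lebesgue_integral_def[OF that]
      by (cases "\<integral>\<^sup>+x. ennreal (- g x) \<partial>lborel"; cases "\<integral>\<^sup>+x. ennreal (g x) \<partial>lborel") auto
  qed
  show ?thesis
  proof (cases "(\<integral>\<^sup>+x. ennreal (- (R.dens x * ln (R.dens x))) \<partial>lborel) = \<infinity>")
    case True
    then show ?thesis unfolding entropy by simp
  next
    case nR: False
    have minus_infinity: "renyi_entropy 1 L = - \<infinity>"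
      if "renyi_entropy 1 L = enn2ereal a - enn2ereal b" "a \<noteq> \<infinity>" "b = \<infinity>" for L a b
      using that by (cases a) auto
    have nP: "(\<integral>\<^sup>+x. ennreal (- (P.dens x * ln (P.dens x))) \<partial>lborel) \<noteq> \<infinity>"
      and nQ: "(\<integral>\<^sup>+x. ennreal (- (Q.dens x * ln (Q.dens x))) \<partial>lborel) \<noteq> \<infinity>"
      using tPR.entropy_finite[OF nR] tQR.entropy_finite[OF nR] .
    have less: "enn2ereal a - b \<noteq> \<infinity>" if "a \<noteq> \<infinity>" "0 \<le> b" for a b
      using that by (cases a; cases b) auto
    have lP: "renyi_entropy 1 (mixture_law K P) \<noteq> \<infinity>" and lQ: "renyi_entropy 1 (mixture_law K Q) \<noteq> \<infinity>"
      unfolding entropy using less[OF nP enn2ereal_nonneg] less[OF nQ enn2ereal_nonneg] .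
    show ?thesis
    \<comment> \<open>An infinite positive-logarithm part makes that entropy
      \<open>- \<infinity>\<close>. Neither endpoint entropy is \<open>\<infinity>\<close>, so the
      left side is then \<open>- \<infinity>\<close>.\<close>
    proof (cases "(\<integral>\<^sup>+x. ennreal (P.dens x * ln (P.dens x)) \<partial>lborel) = \<infinity> \<or>
        (\<integral>\<^sup>+x. ennreal (Q.dens x * ln (Q.dens x)) \<partial>lborel) = \<infinity>")
      case True
      then have "renyi_entropy 1 (mixture_law K P) = - \<infinity> \<or> renyi_entropy 1 (mixture_law K Q) = - \<infinity>"
        using minus_infinity[OF P.shannon_entropy_mixture nP] minus_infinity[OF Q.shannon_entropy_mixture nQ]
        by blast
      then show ?thesis
        using lP lQ t_pos t_less
        by (cases "renyi_entropy 1 (mixture_law K P)"; cases "renyi_entropy 1 (mixture_law K Q)") auto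
    next
      case False
      then have pP: "(\<integral>\<^sup>+x. ennreal (P.dens x * ln (P.dens x)) \<partial>lborel) \<noteq> \<infinity>"
        and pQ: "(\<integral>\<^sup>+x. ennreal (Q.dens x * ln (Q.dens x)) \<partial>lborel) \<noteq> \<infinity>"
        by auto
      note I = shannon_interpolation[OF nR pP pQ]
      show ?thesis
        unfolding entropy lint[OF I(1)] lint[OF I(2)] lint[OF I(3)] using I(4) by simp
    qed
  qed
qed

text \<open>For \<open>\<alpha> > 1\<close> the interpolation bound says that the logarithm of the
  power integral at \<open>R\<close> is at most the weighted mean at \<open>P\<close> and
  \<open>Q\<close>; division by the negative \<open>1 - \<alpha>\<close> reverses the
  inequality.\<close>

lemma renyi_entropy_concave:
  assumes "1 \<le> \<alpha>"
  shows "ereal t * renyi_entropy \<alpha> (mixture_law K P) + ereal (1 - t) * renyi_entropy \<alpha> (mixture_law K Q) \<le>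
    renyi_entropy \<alpha> (mixture_law K (\<lambda>y. t * P y + (1 - t) * Q y))"
proof (cases "\<alpha> = 1")
  case True
  then show ?thesis using shannon_entropy_concave by simp
next
  case False
  with assms have \<alpha>: "1 < \<alpha>" by simp
  define a b c where "a = (\<integral>\<^sup>+x. ennreal (P.dens x powr \<alpha>) \<partial>lborel)"
    and "b = (\<integral>\<^sup>+x. ennreal (Q.dens x powr \<alpha>) \<partial>lborel)"
    and "c = (\<integral>\<^sup>+x. ennreal (R.dens x powr \<alpha>) \<partial>lborel)"
  have nonzero: "a \<noteq> 0" "b \<noteq> 0" "c \<noteq> 0"
    unfolding a_def b_def c_def
    by (rule P.nn_integral_dens_powr_nonzero Q.nn_integral_dens_powr_nonzero R.nn_integral_dens_powr_nonzero)+
  note entropy = P.renyi_entropy_mixture[OF \<alpha>, folded a_def] Q.renyi_entropy_mixture[OF \<alpha>, folded b_def]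
    R.renyi_entropy_mixture[OF \<alpha>, folded c_def]
  show ?thesis
  \<comment> \<open>A divergent power integral at an endpoint makes its entropy
    \<open>- \<infinity>\<close>, and for \<open>\<alpha> > 1\<close> the other one is never
    \<open>\<infinity>\<close>, so the left side is \<open>- \<infinity>\<close>.\<close>
  proof (cases "a = \<infinity> \<or> b = \<infinity>")
    case True
    then show ?thesis
      unfolding entropy using t_pos t_less by auto
  next
    case False
    then obtain A B where A: "a = ennreal A" "0 < A" and B: "b = ennreal B" "0 < B"
      using nonzero by (cases a; cases b) (auto simp: order.order_iff_strict)
    have le: "c \<le> ennreal (A powr t * B powr (1 - t))"
      using A B unfolding a_def b_def c_def by (intro renyi_interpolation \<alpha>) auto
    then obtain C where C: "c = ennreal C" "0 < C"
      using nonzero by (cases c) (auto simp: order.order_iff_strict top_unique)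
    have "C \<le> A powr t * B powr (1 - t)"
      using le C by (simp add: ennreal_le_iff)
    then have "ln C \<le> ln (A powr t * B powr (1 - t))"
      using C by (intro ln_mono) auto
    also have "\<dots> = t * ln A + (1 - t) * ln B"
      using A B by (simp add: ln_mult ln_powr)
    finally have "(t * ln A + (1 - t) * ln B) / (1 - \<alpha>) \<le> ln C / (1 - \<alpha>)"
      using \<alpha> by (intro divide_right_mono_neg) auto
    then show ?thesis
      unfolding entropy using A B C by (simp add: add_divide_distrib)
  qed
qed

end

section \<open>Concavity on the simplex\<close>

lemma mixing_variance_pos:
  assumes "p \<in> std_simplex n"
  shows "0 < mixing_variance p n y"
proof -
  have p: "\<And>i. i < n \<Longrightarrow> 0 \<le> p i" "(\<Sum>i<n. p i) = 1"
    using assms by (auto simp: std_simplex_def)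
  have "\<exists>i<n. p i \<noteq> 0"
    using p(2) by (metis lessThan_iff sum.neutral zero_neq_one)
  then obtain i where "i < n" "0 < p i"
    using p(1) by (auto simp: order.order_iff_strict)
  then show ?thesis
    unfolding mixing_variance_def using p(1)
    by (intro sum_pos2[of _ i]) (auto intro!: mult_nonneg_nonneg)
qed

theorem theorem2:
  fixes M :: "'a measure" and X :: "nat \<Rightarrow> 'a \<Rightarrow> real" and n :: nat and \<alpha> :: real
  assumes "prob_space M"
    and "\<And>i. i < n \<Longrightarrow> X i \<in> borel_measurable M"
    and "prob_space.indep_vars M (\<lambda>_. borel) X {..<n}"
    and "\<And>i. i < n \<Longrightarrow> gaussian_mixture M (X i)"
    and "\<alpha> \<ge> 1"
  shows "concave_on_simplex n
           (\<lambda>p. renyi_entropy \<alpha> (distr M borel (\<lambda>\<omega>. \<Sum>i<n. sqrt (p i) * X i \<omega>)))"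
proof -
  let ?H = "\<lambda>p. renyi_entropy \<alpha> (distr M borel (\<lambda>\<omega>. \<Sum>i<n. sqrt (p i) * X i \<omega>))"
  obtain K where K: "prob_space K" and meas: "\<And>p. mixing_variance p n \<in> borel_measurable K"
    and law: "\<And>p. \<forall>i<n. 0 \<le> p i \<Longrightarrow>
       distr M borel (\<lambda>\<omega>. \<Sum>i<n. sqrt (p i) * X i \<omega>) = mixture_law K (mixing_variance p n)"
    using weighted_mixture_sum_law[OF assms(1-4)] by blast
  show ?thesis
    unfolding concave_on_simplex_def
  proof (intro ballI allI impI)
    fix p q and t :: real
    assume p: "p \<in> std_simplex n" and q: "q \<in> std_simplex n" and t: "0 \<le> t \<and> t \<le> 1"
    \<comment> \<open>At \<open>t = 0\<close> and \<open>t = 1\<close> both sides agree because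
      \<open>0\<close> times an infinite value is \<open>0\<close> in \<open>ereal\<close>; the
      interpolation locale covers only the interior.\<close>
    consider "t = 0" | "t = 1" | "0 < t" "t < 1"
      using t by linarith
    then show "ereal t * ?H p + ereal (1 - t) * ?H q \<le> ?H (\<lambda>i. t * p i + (1 - t) * q i)"
    proof cases
      case 3
      interpret K: prob_space K by (rule K)
      interpret mixing_interpolation K "mixing_variance p n" "mixing_variance q n" t
        by unfold_locales (use meas p q 3 in \<open>auto intro: mixing_variance_pos\<close>)
      have nonneg: "\<forall>i<n. 0 \<le> p i" "\<forall>i<n. 0 \<le> q i"
        using p q by (auto simp: std_simplex_def)
      then have "\<forall>i<n. 0 \<le> t * p i + (1 - t) * q i"
        using 3 by auto
      \<comment> \<open>The mixing variance is linear in the weights, so the interpolated point of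
        the simplex has exactly the interpolated variance on \<open>K\<close>.\<close>
      moreover have "mixing_variance (\<lambda>i. t * p i + (1 - t) * q i) n =
          (\<lambda>y. t * mixing_variance p n y + (1 - t) * mixing_variance q n y)"
        by (rule ext) (simp add: mixing_variance_def sum_distrib_left sum.distrib[symmetric] algebra_simps)
      ultimately show ?thesis
        using renyi_entropy_concave[OF \<open>\<alpha> \<ge> 1\<close>] by (simp add: law nonneg)
    qed (simp_all add: zero_ereal_def[symmetric])
  qed
qed

end
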